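(* Let $\Sigma$ be a ring of subsets of a non-empty set $\Omega$. The family $\Theta_{\mathcal{S}}=\{\Theta_S;\ S\in\mathcal S\}$ of all spaces of semi-copula-based probabilistic submeasures on $\Sigma$, with the operations $\sqcup$ and $\sqcap$, is a distributive lattice.
   Context: A binary aggregation function is a function $A:[0,1]^2\to[0,1]$ that is non-decreasing in each variable with $A(0,0)=0$ and $A(1,1)=1$. A semi-copula is an aggregation function $S:[0,1]^2\to[0,1]$ with $1$ as its neutral element, i.e. $S(x,1)=S(1,x)=x$ for all $x\in[0,1]$; $\mathcal S$ is the set of all semi-copulas, ordered point-wise by $\leq$, with $\vee,\wedge$ denoting point-wise supremum and infimum. $\Delta^+$ is the set of distance distribution functions: non-decreasing functions $F:[-\infty,+\infty]\to[0,1]$, left-continuous on $\mathbb R$, with $F(x)=0$ for $x\le 0$ and $F(+\infty)=1$. $\varepsilon_0(x)=1$ for $x>0$ and $0$ otherwise. For $S\in\mathcal S$, $\Theta_S$ denotes the set of all $\tau_S$-submeasures on $\Sigma$, i.e. mappings $\gamma:\Sigma\to\Delta^+$ (with $\gamma(E)$ written $\gamma_E$) such that: (a') $\gamma_\emptyset(x)=\varepsilon_0(x)$ for $x>0$; (b') $\gamma_E(x)\ge\gamma_F(x)$ for $x>0$ whenever $E\subset F$, $E,F\in\Sigma$; (c') $\gamma_{E\cup F}(x+y)\ge S(\gamma_E(x),\gamma_F(y))$ for all $x,y>0$, $E,F\in\Sigma$. The elements $\Theta_S$ of $\Theta_{\mathcal S}$ are regarded as indexed by $S\in\mathcal S$,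 and the order and operations are defined through the indices: $\Theta_{S_1}\ll\Theta_{S_2}$ if and only if $S_2\le S_1$; $\Theta_{S_1}\sqcup\Theta_{S_2}=\Theta_{S_1\wedge S_2}$ (join) and $\Theta_{S_1}\sqcap\Theta_{S_2}=\Theta_{S_1\vee S_2}$ (meet). *)

theory Defs
  imports
    "HOL-Algebra.Lattice"
    "HOL-Analysis.Sigma_Algebra"
    "HOL-Library.Extended_Real"
begin

abbreviation unit_square :: "(real \<times> real) set" where
  "unit_square \<equiv> {0..1} \<times> {0..1}"

text \<open>Functions on the unit square are represented extensionally (\<open>undefined\<close> outside of it),
  so that HOL equality is equality of functions on the unit square.\<close>

definition aggregation_functions :: "(real \<times> real \<Rightarrow> real) set" where
  "aggregation_functions =
     {A \<in> unit_square \<rightarrow>\<^sub>E {0..1}.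
        (\<forall>y\<in>{0..1}. mono_on {0..1} (\<lambda>x. A (x, y))) \<and>
        (\<forall>x\<in>{0..1}. mono_on {0..1} (\<lambda>y. A (x, y))) \<and>
        A (0, 0) = 0 \<and> A (1, 1) = 1}"

definition semicopulas :: "(real \<times> real \<Rightarrow> real) set" where
  "semicopulas = {S \<in> aggregation_functions. \<forall>x\<in>{0..1}. S (x, 1) = x \<and> S (1, x) = x}"

definition pointwise_le :: "(real \<times> real \<Rightarrow> real) \<Rightarrow> (real \<times> real \<Rightarrow> real) \<Rightarrow> bool" where
  "pointwise_le S T \<longleftrightarrow> (\<forall>p\<in>unit_square. S p \<le> T p)"

definition pointwise_sup ::
    "(real \<times> real \<Rightarrow> real) \<Rightarrow> (real \<times> real \<Rightarrow> real) \<Rightarrow> real \<times> real \<Rightarrow> real" where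
  "pointwise_sup S T = (\<lambda>p\<in>unit_square. max (S p) (T p))"

definition pointwise_inf ::
    "(real \<times> real \<Rightarrow> real) \<Rightarrow> (real \<times> real \<Rightarrow> real) \<Rightarrow> real \<times> real \<Rightarrow> real" where
  "pointwise_inf S T = (\<lambda>p\<in>unit_square. min (S p) (T p))"

definition distance_distributions :: "(ereal \<Rightarrow> real) set" where
  "distance_distributions =
     {F. range F \<subseteq> {0..1} \<and> mono F \<and>
         (\<forall>r::real. continuous (at_left (ereal r)) F) \<and>
         (\<forall>x\<le>0. F x = 0) \<and> F \<infinity> = 1}"

definition eps0 :: "ereal \<Rightarrow> real" where
  "eps0 x = (if x > 0 then 1 else 0)"

text \<open>The variables \<open>x\<close>, \<open>y\<close> range over all positive extended reals, the positive part of the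
  domain of a distance distribution function; at \<open>\<infinity>\<close> the conditions hold automatically
  when \<open>S\<close> is a semi-copula.\<close>

definition submeasures ::
    "'a set set \<Rightarrow> (real \<times> real \<Rightarrow> real) \<Rightarrow> ('a set \<Rightarrow> ereal \<Rightarrow> real) set" where
  "submeasures \<Sigma> S =
     {\<gamma> \<in> \<Sigma> \<rightarrow>\<^sub>E distance_distributions.
        (\<forall>x>0. \<gamma> {} x = eps0 x) \<and>
        (\<forall>E\<in>\<Sigma>. \<forall>F\<in>\<Sigma>. E \<subseteq> F \<longrightarrow> (\<forall>x>0. \<gamma> E x \<ge> \<gamma> F x)) \<and>
        (\<forall>E\<in>\<Sigma>. \<forall>F\<in>\<Sigma>. \<forall>x>0. \<forall>y>0. \<gamma> (E \<union> F) (x + y) \<ge> S (\<gamma> E x, \<gamma> F y))}"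

text \<open>Different semi-copulas may have the same set of submeasures (for example if
  \<open>\<Sigma> = {{}}\<close>), so operations defined through the indices do not descend to the bare sets.
  A member of the family indexed by \<open>S\<close> therefore carries its index.\<close>

type_synonym 'a submeasure_space =
  "(real \<times> real \<Rightarrow> real) \<times> ('a set \<Rightarrow> ereal \<Rightarrow> real) set"

definition Theta :: "'a set set \<Rightarrow> (real \<times> real \<Rightarrow> real) \<Rightarrow> 'a submeasure_space" where
  "Theta \<Sigma> S = (S, submeasures \<Sigma> S)"

abbreviation index :: "'a submeasure_space \<Rightarrow> real \<times> real \<Rightarrow> real" where
  "index \<equiv> fst"

definition Theta_join ::
    "'a set set \<Rightarrow> 'a submeasure_space \<Rightarrow> 'a submeasure_space \<Rightarrow> 'a submeasure_space" where
  "Theta_join \<Sigma> X Y = Theta \<Sigma> (pointwise_inf (index X) (index Y))"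

definition Theta_meet ::
    "'a set set \<Rightarrow> 'a submeasure_space \<Rightarrow> 'a submeasure_space \<Rightarrow> 'a submeasure_space" where
  "Theta_meet \<Sigma> X Y = Theta \<Sigma> (pointwise_sup (index X) (index Y))"

definition Theta_order :: "'a set set \<Rightarrow> 'a submeasure_space gorder" where
  "Theta_order \<Sigma> =
     \<lparr>carrier = Theta \<Sigma> ` semicopulas, eq = (=),
      le = (\<lambda>X Y. pointwise_le (index Y) (index X))\<rparr>"

locale distributive_lattice = lattice +
  assumes meet_join_distrib:
      "\<lbrakk>x \<in> carrier L; y \<in> carrier L; z \<in> carrier L\<rbrakk> \<Longrightarrow>
        x \<sqinter> (y \<squnion> z) = (x \<sqinter> y) \<squnion> (x \<sqinter> z)"
    and join_meet_distrib:
      "\<lbrakk>x \<in> carrier L; y \<in> carrier L; z \<in> carrier L\<rbrakk> \<Longrightarrow>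
        x \<squnion> (y \<sqinter> z) = (x \<squnion> y) \<sqinter> (x \<squnion> z)"

end

theory Submission
  imports Defs
begin

text \<open>Everything happens on the indices. The point-wise minimum and maximum of two semi-copulas
  are again semi-copulas, since both operations preserve monotonicity and are idempotent, hence
  keep the boundary values that all semi-copulas share. So the semi-copulas form a
  sublattice of the lattice of real functions on the unit square, which is distributive because
  \<open>min\<close> and \<open>max\<close> distribute over each other in a linear order. As a member of the family carries
  its index, \<open>S \<mapsto> \<Theta>\<^sub>S\<close> is an order-reversing bijection from the semi-copulas onto the family:
  it turns point-wise infima into joins and point-wise suprema into meets, and distributivity
  is a self-dual property.\<close>

lemma pointwise_inf_semicopula:
  assumes S: "S \<in> semicopulas" and T: "T \<in> semicopulas"
  shows "pointwise_inf S T \<in> semicopulas"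
proof -
  have fst: "min (S (x, y)) (T (x, y)) \<le> min (S (x', y)) (T (x', y))"
    if "x \<in> {0..1}" "x' \<in> {0..1}" "y \<in> {0..1}" "x \<le> x'" for x x' y
    using S T that
    by (intro min.mono) (auto simp: semicopulas_def aggregation_functions_def mono_on_def)
  have snd: "min (S (x, y)) (T (x, y)) \<le> min (S (x, y')) (T (x, y'))"
    if "x \<in> {0..1}" "y \<in> {0..1}" "y' \<in> {0..1}" "y \<le> y'" for x y y'
    using S T that
    by (intro min.mono) (auto simp: semicopulas_def aggregation_functions_def mono_on_def)
  have "min (S p) (T p) \<in> {0..1}" if "p \<in> unit_square" for p
    using S T PiE_mem[OF _ that, of S "\<lambda>_. {0..1}"] PiE_mem[OF _ that, of T "\<lambda>_. {0..1}"]
    by (simp add: semicopulas_def aggregation_functions_def min_def)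
  with fst snd S T show ?thesis
    by (simp add: semicopulas_def aggregation_functions_def pointwise_inf_def mono_on_def
        restrict_PiE_iff)
qed

lemma pointwise_sup_semicopula:
  assumes S: "S \<in> semicopulas" and T: "T \<in> semicopulas"
  shows "pointwise_sup S T \<in> semicopulas"
proof -
  have fst: "max (S (x, y)) (T (x, y)) \<le> max (S (x', y)) (T (x', y))"
    if "x \<in> {0..1}" "x' \<in> {0..1}" "y \<in> {0..1}" "x \<le> x'" for x x' y
    using S T that
    by (intro max.mono) (auto simp: semicopulas_def aggregation_functions_def mono_on_def)
  have snd: "max (S (x, y)) (T (x, y)) \<le> max (S (x, y')) (T (x, y'))"
    if "x \<in> {0..1}" "y \<in> {0..1}" "y' \<in> {0..1}" "y \<le> y'" for x y y'
    using S T that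
    by (intro max.mono) (auto simp: semicopulas_def aggregation_functions_def mono_on_def)
  have "max (S p) (T p) \<in> {0..1}" if "p \<in> unit_square" for p
    using S T PiE_mem[OF _ that, of S "\<lambda>_. {0..1}"] PiE_mem[OF _ that, of T "\<lambda>_. {0..1}"]
    by (simp add: semicopulas_def aggregation_functions_def max_def)
  with fst snd S T show ?thesis
    by (simp add: semicopulas_def aggregation_functions_def pointwise_sup_def mono_on_def
        restrict_PiE_iff)
qed

text \<open>Extensionality makes functions that agree on the unit square equal; without it the order
  would only be a preorder.\<close>

lemma pointwise_le_antisym:
  assumes "S \<in> semicopulas" "T \<in> semicopulas" "pointwise_le S T" "pointwise_le T S"
  shows "S = T"
proof (rule PiE_ext)
  show "S \<in> unit_square \<rightarrow>\<^sub>E {0..1}" "T \<in> unit_square \<rightarrow>\<^sub>E {0..1}"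
    using assms(1,2) by (simp_all add: semicopulas_def aggregation_functions_def)
  show "S p = T p" if "p \<in> unit_square" for p
    using assms(3,4) that unfolding pointwise_le_def by (blast intro: order_antisym)
qed

lemma pointwise_le_refl: "pointwise_le S S"
  by (simp add: pointwise_le_def)

lemma pointwise_le_trans: "pointwise_le S T \<Longrightarrow> pointwise_le T U \<Longrightarrow> pointwise_le S U"
  unfolding pointwise_le_def by (meson order_trans)

lemma pointwise_le_inf_iff:
  "pointwise_le S (pointwise_inf T U) \<longleftrightarrow> pointwise_le S T \<and> pointwise_le S U"
  by (auto simp: pointwise_le_def pointwise_inf_def)

lemma pointwise_sup_le_iff:
  "pointwise_le (pointwise_sup S T) U \<longleftrightarrow> pointwise_le S U \<and> pointwise_le T U"
  by (auto simp: pointwise_le_def pointwise_sup_def)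

lemma pointwise_sup_inf_distrib:
  "pointwise_sup S (pointwise_inf T U) = pointwise_inf (pointwise_sup S T) (pointwise_sup S U)"
  unfolding pointwise_sup_def pointwise_inf_def
  by (rule restrict_ext) (simp add: max_min_distrib2)

lemma pointwise_inf_sup_distrib:
  "pointwise_inf S (pointwise_sup T U) = pointwise_sup (pointwise_inf S T) (pointwise_inf S U)"
  unfolding pointwise_sup_def pointwise_inf_def
  by (rule restrict_ext) (simp add: min_max_distrib2)

lemma index_Theta [simp]: "index (Theta \<Sigma> S) = S"
  by (simp add: Theta_def)

lemma carrier_Theta_order [simp]: "carrier (Theta_order \<Sigma>) = Theta \<Sigma> ` semicopulas"
  by (simp add: Theta_order_def)

lemma le_Theta_order [simp]:
  "X \<sqsubseteq>\<^bsub>Theta_order \<Sigma>\<^esub> Y \<longleftrightarrow> pointwise_le (index Y) (index X)"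
  by (simp add: Theta_order_def)

lemma partial_order_Theta_order: "partial_order (Theta_order \<Sigma>)"
proof (unfold_locales, goal_cases)
  \<comment> \<open>The index determines the space, so antisymmetry is inherited from the semi-copulas.\<close>
  case (5 X Y)
  then show ?case by (auto simp: Theta_order_def dest: pointwise_le_antisym)
qed (auto simp: Theta_order_def pointwise_le_refl elim: pointwise_le_trans)

lemma Theta_join_is_lub:
  assumes X: "X \<in> carrier (Theta_order \<Sigma>)" and Y: "Y \<in> carrier (Theta_order \<Sigma>)"
  shows "is_lub (Theta_order \<Sigma>) (Theta_join \<Sigma> X Y) {X, Y}"
proof (rule least_UpperI)
  let ?I = "pointwise_inf (index X) (index Y)"
  show "{X, Y} \<subseteq> carrier (Theta_order \<Sigma>)"
    using X Y by simp
  show "Theta_join \<Sigma> X Y \<in> carrier (Theta_order \<Sigma>)"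
    using X Y by (auto simp: Theta_join_def intro: pointwise_inf_semicopula)
  have "pointwise_le ?I (index X) \<and> pointwise_le ?I (index Y)"
    using pointwise_le_inf_iff pointwise_le_refl by blast
  then show "Z \<sqsubseteq>\<^bsub>Theta_order \<Sigma>\<^esub> Theta_join \<Sigma> X Y" if "Z \<in> {X, Y}" for Z
    using that by (auto simp: Theta_join_def)
  show "Theta_join \<Sigma> X Y \<sqsubseteq>\<^bsub>Theta_order \<Sigma>\<^esub> Z"
    if "Z \<in> Upper (Theta_order \<Sigma>) {X, Y}" for Z
    using that X Y by (auto simp: Theta_join_def Upper_def pointwise_le_inf_iff simp del: split_paired_All)
qed

lemma Theta_meet_is_glb:
  assumes X: "X \<in> carrier (Theta_order \<Sigma>)" and Y: "Y \<in> carrier (Theta_order \<Sigma>)"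
  shows "is_glb (Theta_order \<Sigma>) (Theta_meet \<Sigma> X Y) {X, Y}"
proof (rule greatest_LowerI)
  let ?J = "pointwise_sup (index X) (index Y)"
  show "{X, Y} \<subseteq> carrier (Theta_order \<Sigma>)"
    using X Y by simp
  show "Theta_meet \<Sigma> X Y \<in> carrier (Theta_order \<Sigma>)"
    using X Y by (auto simp: Theta_meet_def intro: pointwise_sup_semicopula)
  have "pointwise_le (index X) ?J \<and> pointwise_le (index Y) ?J"
    using pointwise_sup_le_iff pointwise_le_refl by blast
  then show "Theta_meet \<Sigma> X Y \<sqsubseteq>\<^bsub>Theta_order \<Sigma>\<^esub> Z" if "Z \<in> {X, Y}" for Z
    using that by (auto simp: Theta_meet_def)
  show "Z \<sqsubseteq>\<^bsub>Theta_order \<Sigma>\<^esub> Theta_meet \<Sigma> X Y"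
    if "Z \<in> Lower (Theta_order \<Sigma>) {X, Y}" for Z
    using that X Y by (auto simp: Theta_meet_def Lower_def pointwise_sup_le_iff simp del: split_paired_All)
qed

lemma lattice_Theta_order: "lattice (Theta_order \<Sigma>)"
proof -
  interpret partial_order "Theta_order \<Sigma>"
    by (rule partial_order_Theta_order)
  show ?thesis
    by unfold_locales (blast intro: Theta_join_is_lub Theta_meet_is_glb)+
qed

lemma join_Theta_order:
  assumes "X \<in> carrier (Theta_order \<Sigma>)" "Y \<in> carrier (Theta_order \<Sigma>)"
  shows "X \<squnion>\<^bsub>Theta_order \<Sigma>\<^esub> Y = Theta_join \<Sigma> X Y"
proof -
  interpret lattice "Theta_order \<Sigma>"
    by (rule lattice_Theta_order)
  show ?thesis
    by (rule least_unique[OF sup_of_two_least[OF assms, folded join_def]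
          Theta_join_is_lub[OF assms]])
qed

lemma meet_Theta_order:
  assumes "X \<in> carrier (Theta_order \<Sigma>)" "Y \<in> carrier (Theta_order \<Sigma>)"
  shows "X \<sqinter>\<^bsub>Theta_order \<Sigma>\<^esub> Y = Theta_meet \<Sigma> X Y"
proof -
  interpret lattice "Theta_order \<Sigma>"
    by (rule lattice_Theta_order)
  show ?thesis
    by (rule greatest_unique[OF inf_of_two_greatest[OF assms, folded meet_def]
          Theta_meet_is_glb[OF assms]])
qed

theorem proposition4p4:
  fixes \<Omega> :: "'a set" and \<Sigma> :: "'a set set"
  assumes "\<Omega> \<noteq> {}" and "ring_of_sets \<Omega> \<Sigma>"
  shows "distributive_lattice (Theta_order \<Sigma>) \<and>
    (\<forall>X \<in> carrier (Theta_order \<Sigma>). \<forall>Y \<in> carrier (Theta_order \<Sigma>).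
       X \<squnion>\<^bsub>Theta_order \<Sigma>\<^esub> Y = Theta_join \<Sigma> X Y \<and>
       X \<sqinter>\<^bsub>Theta_order \<Sigma>\<^esub> Y = Theta_meet \<Sigma> X Y)"
proof (intro conjI ballI)
  interpret lattice "Theta_order \<Sigma>"
    by (rule lattice_Theta_order)
  show "distributive_lattice (Theta_order \<Sigma>)"
  proof
    fix X Y Z
    assume XYZ: "X \<in> carrier (Theta_order \<Sigma>)" "Y \<in> carrier (Theta_order \<Sigma>)"
      "Z \<in> carrier (Theta_order \<Sigma>)"
    note closed = join_closed[OF XYZ(2,3)] join_closed[OF XYZ(1,2)] join_closed[OF XYZ(1,3)]
      meet_closed[OF XYZ(2,3)] meet_closed[OF XYZ(1,2)] meet_closed[OF XYZ(1,3)]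
    \<comment> \<open>Passing to indices exchanges the two distributive laws.\<close>
    show "X \<sqinter>\<^bsub>Theta_order \<Sigma>\<^esub> (Y \<squnion>\<^bsub>Theta_order \<Sigma>\<^esub> Z) =
        (X \<sqinter>\<^bsub>Theta_order \<Sigma>\<^esub> Y) \<squnion>\<^bsub>Theta_order \<Sigma>\<^esub> (X \<sqinter>\<^bsub>Theta_order \<Sigma>\<^esub> Z)"
      using XYZ closed
      by (simp add: join_Theta_order meet_Theta_order Theta_join_def Theta_meet_def
          pointwise_sup_inf_distrib del: carrier_Theta_order)
    show "X \<squnion>\<^bsub>Theta_order \<Sigma>\<^esub> (Y \<sqinter>\<^bsub>Theta_order \<Sigma>\<^esub> Z) =
        (X \<squnion>\<^bsub>Theta_order \<Sigma>\<^esub> Y) \<sqinter>\<^bsub>Theta_order \<Sigma>\<^esub> (X \<squnion>\<^bsub>Theta_order \<Sigma>\<^esub> Z)"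
      using XYZ closed
      by (simp add: join_Theta_order meet_Theta_order Theta_join_def Theta_meet_def
          pointwise_inf_sup_distrib del: carrier_Theta_order)
  qed
qed (fact join_Theta_order meet_Theta_order)+

end
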